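(* Consider the Kac model on the state space $\mathbb{R}$ with uncertain collision angle $\theta$ uniformly distributed in $[0,2\pi]$, let $g$ be a solution of the deterministic Boltzmann-type model and $\{f(\cdot,\cdot;\theta)\}_{\theta\in[0,2\pi]}$ a family of solutions of the stochastic Boltzmann-type model, with $m_g(0)=1$ and $m_f(0;\theta)=1$ for all $\theta\in[0,2\pi]$. Then for all $t\ge 0$ and $\theta\in[0,2\pi]$ $$m_g(t)=e^{-t},\qquad m_f(t;\theta)=e^{(\cos\theta-1)t},\qquad m_{\bar f}(t)=\frac{1}{2\pi}\int_0^{2\pi}e^{(\cos\theta-1)t}\,d\theta .$$ Both means tend to zero, i.e. $\lim_{t\to+\infty}m_g(t)=\lim_{t\to+\infty}m_{\bar f}(t)=0$, but for all $t>0$ $$m_{\bar f}(t)\ \ge\ \frac{1}{\sqrt{2\pi t}}\,\operatorname{Erf}\!\left(\pi\sqrt{\frac t2}\right),$$ where $\operatorname{Erf}(x)=\frac{2}{\sqrt\pi}\int_0^x e^{-y^2}\,dy$; hence the convergence of $m_{\bar f}$ to zero is much slower than the exponential convergence of $m_g$.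
   Context: Binary interactions (Kac model): for pre-interaction states $v,w\in\mathbb{R}$ and $\theta\in[0,2\pi]$, the post-interaction states are $$v^\ast=\cos\theta\,v-\sin\theta\,w,\qquad w^\ast=\sin\theta\,v+\cos\theta\,w .$$ The random variable $\theta$ has density $\rho(\theta)=\frac1{2\pi}\mathbf 1_{[0,2\pi]}(\theta)$. Deterministic model: $g(t,\cdot)$ is a probability density on $\mathbb{R}$ for each $t\ge0$ such that, for test functions $\varphi$, $$\frac{d}{dt}\int_{\mathbb{R}}\varphi(v)g(t,v)\,dv=\frac12\iint_{\mathbb{R}^2}\int_0^{2\pi}\big(\varphi(v^\ast)+\varphi(w^\ast)-\varphi(v)-\varphi(w)\big)\rho(\theta)g(t,v)g(t,w)\,d\theta\,dv\,dw .$$ Stochastic model: for each $\theta\in[0,2\pi]$, $f(t,\cdot;\theta)$ is a probability density on $\mathbb{R}$ for each $t\ge0$ such that, for test functions $\varphi$, $$\frac{d}{dt}\int_{\mathbb{R}}\varphi(v)f(t,v;\theta)\,dv=\frac12\iint_{\mathbb{R}^2}\big(\varphi(v^\ast)+\varphi(w^\ast)-\varphi(v)-\varphi(w)\big)f(t,v;\theta)f(t,w;\theta)\,dv\,dw .$$ It is assumed that first absolute moments in $v$ are finite for all $t\ge 0$ and that $\varphi(v)=v$ is an admissible test function. Notation: $m_g(t)=\int_{\mathbb{R}}v\,g(t,v)\,dv$, $m_f(t;\theta)=\int_{\mathbb{R}}v f(t,v;\theta)\,dv$, and $m_{\bar f}(t)=\int_0^{2\pi}m_f(t;\theta)\rho(\theta)\,d\theta$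 (the mean of the $\theta$-averaged distribution $\bar f(t,v)=\int_0^{2\pi} f(t,v;\theta)\rho(\theta)\,d\theta$). *)

theory Defs
  imports "HOL-Analysis.Analysis" "HOL-Library.Landau_Symbols"
begin

definition v_post :: "real \<Rightarrow> real \<Rightarrow> real \<Rightarrow> real" where
  "v_post \<theta> v w = cos \<theta> * v - sin \<theta> * w"

definition w_post :: "real \<Rightarrow> real \<Rightarrow> real \<Rightarrow> real" where
  "w_post \<theta> v w = sin \<theta> * v + cos \<theta> * w"

definition rho :: "real \<Rightarrow> real" where
  "rho \<theta> = 1 / (2 * pi) * indicator {0..2 * pi} \<theta>"

definition prob_density :: "(real \<Rightarrow> real) \<Rightarrow> bool" where
  "prob_density p \<longleftrightarrow> (\<forall>v. 0 \<le> p v) \<and> has_bochner_integral lborel p 1"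

definition mean :: "(real \<Rightarrow> real) \<Rightarrow> real" where
  "mean p = (LBINT v. v * p v)"

definition finite_first_moment :: "(real \<Rightarrow> real) \<Rightarrow> bool" where
  "finite_first_moment p \<longleftrightarrow> integrable lborel (\<lambda>v. \<bar>v\<bar> * p v)"

definition collision_diff :: "(real \<Rightarrow> real) \<Rightarrow> real \<Rightarrow> real \<Rightarrow> real \<Rightarrow> real" where
  "collision_diff \<phi> \<theta> v w = \<phi> (v_post \<theta> v w) + \<phi> (w_post \<theta> v w) - \<phi> v - \<phi> w"

definition deterministic_rhs :: "(real \<Rightarrow> real) \<Rightarrow> (real \<Rightarrow> real) \<Rightarrow> real" where
  "deterministic_rhs \<phi> p =
     1 / 2 * (\<integral>(v, w). (LBINT \<theta>:{0..2 * pi}. collision_diff \<phi> \<theta> v w * rho \<theta> * p v * p w)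
       \<partial>(lborel \<Otimes>\<^sub>M lborel))"

definition stochastic_rhs :: "(real \<Rightarrow> real) \<Rightarrow> real \<Rightarrow> (real \<Rightarrow> real) \<Rightarrow> real" where
  "stochastic_rhs \<phi> \<theta> p =
     1 / 2 * (\<integral>(v, w). collision_diff \<phi> \<theta> v w * p v * p w \<partial>(lborel \<Otimes>\<^sub>M lborel))"

(* The set T is the class of test functions. Bochner integrals of non-integrable
   functions are 0, so the existence of the integrals in the weak equation is stated
   explicitly; for the test function v |-> v it follows from a finite first moment.
   Time is [0, \<infinity>), so the derivative at t = 0 is one-sided. *)

definition deterministic_solution :: "(real \<Rightarrow> real) set \<Rightarrow> (real \<Rightarrow> real \<Rightarrow> real) \<Rightarrow> bool" where
  "deterministic_solution T g \<longleftrightarrow>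
     (\<forall>t\<ge>0. prob_density (g t)) \<and>
     (\<forall>\<phi>\<in>T. \<forall>t\<ge>0.
        integrable lborel (\<lambda>v. \<phi> v * g t v) \<and>
        integrable ((lborel \<Otimes>\<^sub>M lborel) \<Otimes>\<^sub>M lborel)
          (\<lambda>((v, w), \<theta>). collision_diff \<phi> \<theta> v w * rho \<theta> * g t v * g t w) \<and>
        ((\<lambda>s. LBINT v. \<phi> v * g s v) has_real_derivative deterministic_rhs \<phi> (g t))
          (at t within {0..}))"

definition stochastic_solution ::
    "(real \<Rightarrow> real) set \<Rightarrow> real \<Rightarrow> (real \<Rightarrow> real \<Rightarrow> real) \<Rightarrow> bool" where
  "stochastic_solution T \<theta> f \<longleftrightarrow>
     (\<forall>t\<ge>0. prob_density (f t)) \<and>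
     (\<forall>\<phi>\<in>T. \<forall>t\<ge>0.
        integrable lborel (\<lambda>v. \<phi> v * f t v) \<and>
        integrable (lborel \<Otimes>\<^sub>M lborel)
          (\<lambda>(v, w). collision_diff \<phi> \<theta> v w * f t v * f t w) \<and>
        ((\<lambda>s. LBINT v. \<phi> v * f s v) has_real_derivative stochastic_rhs \<phi> \<theta> (f t))
          (at t within {0..}))"

(* In a family f of solutions, f \<theta> t v stands for f(t, v; \<theta>). *)

definition averaged_mean :: "(real \<Rightarrow> real \<Rightarrow> real \<Rightarrow> real) \<Rightarrow> real \<Rightarrow> real" where
  "averaged_mean f t = (LBINT \<theta>:{0..2 * pi}. mean (f \<theta> t) * rho \<theta>)"

definition Erf :: "real \<Rightarrow> real" where
  "Erf x = 2 / sqrt pi * (LBINT y=ereal 0..ereal x. exp (- (y\<^sup>2)))"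

end

theory Submission
  imports Defs "HOL-Real_Asymp.Real_Asymp"
begin

text \<open>Tested against \<open>v\<close>, the mixed terms in \<open>sin \<theta>\<close> cancel because both particles have the same law,
  so the mean solves \<open>m' = (cos \<theta> - 1) m\<close>; averaging the rate over \<open>\<theta>\<close> gives \<open>m' = - m\<close>.
  The averaged mean is governed by the angles near \<open>0\<close> and \<open>2 \<pi>\<close>, where the decay rate vanishes:
  \<open>cos \<theta> - 1 \<ge> - \<theta>\<^sup>2 / 2\<close> turns the average into a Gaussian integral of order \<open>1 / sqrt t\<close>.\<close>

section \<open>Weak equations tested against the identity\<close>

lemma integrable_lborel_product:
  fixes a b :: "real \<Rightarrow> real"
  assumes a: "integrable lborel a" and b: "integrable lborel b"
  shows "integrable (lborel \<Otimes>\<^sub>M lborel) (\<lambda>(v, w). a v * b w)"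
    and "(\<integral>(v, w). a v * b w \<partial>(lborel \<Otimes>\<^sub>M lborel)) = (LBINT v. a v) * (LBINT w. b w)"
proof -
  have [measurable]: "a \<in> borel_measurable borel" "b \<in> borel_measurable borel"
    using borel_measurable_integrable[OF a] borel_measurable_integrable[OF b] by auto
  show i: "integrable (lborel \<Otimes>\<^sub>M lborel) (\<lambda>(v, w). a v * b w)"
  proof (rule lborel_pair.Fubini_integrable)
    show "(\<lambda>(v, w). a v * b w) \<in> borel_measurable (lborel \<Otimes>\<^sub>M lborel)"
      by measurable
    have "(\<lambda>x. LBINT y. norm (case (x, y) of (v, w) \<Rightarrow> a v * b w)) = (\<lambda>x. \<bar>a x\<bar> * (LBINT y. \<bar>b y\<bar>))"
      by (simp add: abs_mult)
    then show "integrable lborel (\<lambda>x. LBINT y. norm (case (x, y) of (v, w) \<Rightarrow> a v * b w))"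
      using a by simp
    show "AE x in lborel. integrable lborel (\<lambda>y. case (x, y) of (v, w) \<Rightarrow> a v * b w)"
      using b by simp
  qed
  show "(\<integral>(v, w). a v * b w \<partial>(lborel \<Otimes>\<^sub>M lborel)) = (LBINT v. a v) * (LBINT w. b w)"
    using lborel_pair.integral_fst'[OF i] by simp
qed

text \<open>Since \<open>p\<close> has mass 1, \<open>v\<close> and \<open>w\<close> each integrate
  to \<open>mean p\<close> against the product density, so only the sum \<open>a + b\<close>
  survives. This is where opposite coefficients cancel.\<close>

lemma integral_linear_product_density:
  assumes p: "prob_density p" and m: "integrable lborel (\<lambda>v. v * p v)"
  shows "(\<integral>(v, w). (a * v + b * w) * p v * p w \<partial>(lborel \<Otimes>\<^sub>M lborel)) = (a + b) * mean p"
proof -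
  have i: "integrable lborel p" and one: "(LBINT v. p v) = 1"
    using p by (auto simp: prob_density_def has_bochner_integral_iff)
  have "(\<integral>(v, w). (a * v + b * w) * p v * p w \<partial>(lborel \<Otimes>\<^sub>M lborel)) =
    (\<integral>z. a * (case z of (v, w) \<Rightarrow> (v * p v) * p w) + b * (case z of (v, w) \<Rightarrow> p v * (w * p w))
      \<partial>(lborel \<Otimes>\<^sub>M lborel))"
    by (intro Bochner_Integration.integral_cong) (auto simp: algebra_simps)
  \<comment> \<open>Fubini turns each summand into a first moment times a mass. Both summands are
    integrable, which permits splitting the integral of the sum.\<close>
  also have "\<dots> = a * mean p + b * mean p"
    using integrable_lborel_product[OF m i] integrable_lborel_product[OF i m]
    by (simp add: one mean_def)
  finally show ?thesis
    by (simp add: algebra_simps)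
qed

text \<open>The coefficients of \<open>v\<close> and \<open>w\<close> in the collision difference
  add up to \<open>2 * (cos \<theta> - 1)\<close>, the sines cancelling; the prefactor 1/2 removes
  the 2.\<close>

lemma stochastic_rhs_id:
  assumes "prob_density p" "integrable lborel (\<lambda>v. v * p v)"
  shows "stochastic_rhs (\<lambda>v. v) \<theta> p = (cos \<theta> - 1) * mean p"
proof -
  have "(\<integral>(v, w). collision_diff (\<lambda>v. v) \<theta> v w * p v * p w \<partial>(lborel \<Otimes>\<^sub>M lborel)) =
    (\<integral>(v, w). ((cos \<theta> + sin \<theta> - 1) * v + (cos \<theta> - sin \<theta> - 1) * w) * p v * p w \<partial>(lborel \<Otimes>\<^sub>M lborel))"
    by (intro Bochner_Integration.integral_cong)
      (auto simp: collision_diff_def v_post_def w_post_def algebra_simps)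
  then show ?thesis
    unfolding stochastic_rhs_def integral_linear_product_density[OF assms] by (simp add: algebra_simps)
qed

text \<open>Sine and cosine average to zero over a full period, leaving only the loss term. The
  right-hand side is written as \<open>- 1 * v + - 1 * w\<close> so that it matches the linear form
  \<open>a * v + b * w\<close> of \<open>integral_linear_product_density\<close>.\<close>

lemma integral_collision_diff_id:
  "(LBINT \<theta>:{0..2 * pi}. collision_diff (\<lambda>v. v) \<theta> v w * rho \<theta> * a * b) = (- 1 * v + - 1 * w) * a * b"
proof -
  \<comment> \<open>On the interval \<open>rho\<close> equals \<open>1 / (2 * pi)\<close>;
    \<open>c\<close> collects it with \<open>a\<close> and \<open>b\<close>. \<open>h\<close> is the
    resulting integrand and \<open>F\<close> its antiderivative, whose periodic terms drop out
    between the endpoints.\<close>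
  define c where "c = a * b / (2 * pi)"
  define F where "F \<theta> = (v * (sin \<theta> - cos \<theta> - \<theta>) + w * (sin \<theta> + cos \<theta> - \<theta>)) * c" for \<theta>
  define h where "h \<theta> = (v * (cos \<theta> + sin \<theta> - 1) + w * (cos \<theta> - sin \<theta> - 1)) * c" for \<theta>
  have "(LBINT \<theta>:{0..2 * pi}. collision_diff (\<lambda>v. v) \<theta> v w * rho \<theta> * a * b) =
    (LBINT \<theta>:{0..2 * pi}. h \<theta>)"
    by (rule set_lebesgue_integral_cong)
      (auto simp: collision_diff_def v_post_def w_post_def rho_def h_def c_def field_simps)
  also have "\<dots> = (LBINT \<theta>=ereal 0..ereal (2 * pi). h \<theta>)"
    by (simp only: interval_integral_Icc pi_ge_zero mult_nonneg_nonneg zero_le_numeral)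
  also have "\<dots> = F (2 * pi) - F 0"
  proof (rule interval_integral_FTC_finite)
    show "continuous_on {min 0 (2 * pi)..max 0 (2 * pi)} h"
      unfolding h_def by (intro continuous_intros)
    show "(F has_vector_derivative h x) (at x within {min 0 (2 * pi)..max 0 (2 * pi)})" for x
      unfolding F_def h_def has_real_derivative_iff_has_vector_derivative[symmetric]
      by (auto intro!: derivative_eq_intros simp: algebra_simps)
  qed
  also have "\<dots> = (- 1 * v + - 1 * w) * a * b"
    by (simp add: F_def c_def field_simps)
  finally show ?thesis .
qed

lemma deterministic_rhs_id:
  assumes "prob_density p" "integrable lborel (\<lambda>v. v * p v)"
  shows "deterministic_rhs (\<lambda>v. v) p = - mean p"
  unfolding deterministic_rhs_def integral_collision_diff_id integral_linear_product_density[OF assms]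
  by simp

section \<open>The differential equation for the mean\<close>

lemma linear_ode_unique:
  fixes m :: "real \<Rightarrow> real"
  assumes d: "\<And>t. t \<ge> 0 \<Longrightarrow> (m has_real_derivative k * m t) (at t within {0..})"
    and t: "t \<ge> 0"
  shows "m t = m 0 * exp (k * t)"
proof -
  \<comment> \<open>Integrating factor: the product is constant on the half-line, with a one-sided
    derivative at 0, and its value at 0 is \<open>m 0\<close>.\<close>
  have "((\<lambda>s. m s * exp (- k * s)) has_real_derivative 0) (at s within {0..})" if "s \<in> {0..}" for s
    using that by (auto intro!: derivative_eq_intros d simp: algebra_simps)
  then obtain c where c: "m s * exp (- k * s) = c" if "s \<in> {0..}" for s
    using has_field_derivative_zero_constant[of "{0::real..}" "\<lambda>s. m s * exp (- k * s)"] by auto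
  have "m t * exp (- k * t) = m 0"
    using c[of t] c[of 0] t by simp
  then show ?thesis
    by (simp add: exp_minus field_simps)
qed

lemma mean_deterministic_solution:
  assumes "(\<lambda>v. v) \<in> T" "deterministic_solution T g" "t \<ge> 0"
  shows "mean (g t) = mean (g 0) * exp (- t)"
proof -
  have "((\<lambda>s. mean (g s)) has_real_derivative - 1 * mean (g t)) (at t within {0..})" if "t \<ge> 0" for t
  proof -
    have "prob_density (g t)" "integrable lborel (\<lambda>v. v * g t v)"
      and "((\<lambda>s. LBINT v. v * g s v) has_real_derivative deterministic_rhs (\<lambda>v. v) (g t)) (at t within {0..})"
      using assms(1,2) that by (auto simp: deterministic_solution_def)
    then show ?thesis
      using deterministic_rhs_id[of "g t"] by (simp add: mean_def)
  qed
  from linear_ode_unique[OF this assms(3)] show ?thesis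
    by simp
qed

lemma mean_stochastic_solution:
  assumes "(\<lambda>v. v) \<in> T" "stochastic_solution T \<theta> f" "t \<ge> 0"
  shows "mean (f t) = mean (f 0) * exp ((cos \<theta> - 1) * t)"
proof -
  have "((\<lambda>s. mean (f s)) has_real_derivative (cos \<theta> - 1) * mean (f t)) (at t within {0..})"
    if "t \<ge> 0" for t
  proof -
    have "prob_density (f t)" "integrable lborel (\<lambda>v. v * f t v)"
      and "((\<lambda>s. LBINT v. v * f s v) has_real_derivative stochastic_rhs (\<lambda>v. v) \<theta> (f t)) (at t within {0..})"
      using assms(1,2) that by (auto simp: stochastic_solution_def)
    then show ?thesis
      using stochastic_rhs_id[of "f t" \<theta>] by (simp add: mean_def)
  qed
  from linear_ode_unique[OF this assms(3)] show ?thesis .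
qed

section \<open>Decay of the averaged mean\<close>

text \<open>Dominated convergence: for \<open>t \<ge> 0\<close> the exponent is nonpositive, so the
  indicator of the interval dominates. The integrand tends to 0 except at the endpoints, where
  \<open>cos \<theta> = 1\<close> keeps it at 1; these form a null set.\<close>

lemma tendsto_integral_exp_cos:
  "((\<lambda>t. LBINT \<theta>:{0..2 * pi}. exp ((cos \<theta> - 1) * t)) \<longlongrightarrow> 0) at_top"
proof -
  have "((\<lambda>t. LBINT \<theta>. indicator {0..2 * pi} \<theta> *\<^sub>R exp ((cos \<theta> - 1) * t)) \<longlongrightarrow> (LBINT \<theta>::real. 0::real)) at_top"
  proof (rule integral_dominated_convergence_at_top)
    show "integrable lborel (indicator {0..2 * pi} :: real \<Rightarrow> real)"
      by simp
    show "\<forall>\<^sub>F t in at_top. AE \<theta> in lborel.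
        norm (indicator {0..2 * pi} \<theta> *\<^sub>R exp ((cos \<theta> - 1) * t)) \<le> indicat_real {0..2 * pi} \<theta>"
      using eventually_ge_at_top[of 0]
      by eventually_elim (auto simp: indicator_def mult_nonpos_nonneg)
    have pointwise: "((\<lambda>t. indicator {0..2 * pi} \<theta> *\<^sub>R exp ((cos \<theta> - 1) * t)) \<longlongrightarrow> 0) at_top"
      if "\<theta> \<noteq> 0" "\<theta> \<noteq> 2 * pi" for \<theta> :: real
    proof (cases "\<theta> \<in> {0..2 * pi}")
      case True
      have "cos \<theta> \<noteq> 1"
      proof
        assume "cos \<theta> = 1"
        then obtain n :: int where n: "\<theta> = of_int n * 2 * pi"
          unfolding cos_one_2pi_int by auto
        \<comment> \<open>The multiples of \<open>2 * pi\<close> in the interval are its two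
          endpoints, both excluded here.\<close>
        with True have "0 \<le> n" "n \<le> 1"
          using pi_gt_zero by (auto simp: zero_le_mult_iff simp del: pi_gt_zero)
        with that n show False
          by (cases "n = 0") auto
      qed
      then have "cos \<theta> - 1 < 0"
        using cos_le_one[of \<theta>] by linarith
      then have "((\<lambda>t. exp ((cos \<theta> - 1) * t)) \<longlongrightarrow> 0) at_top"
        by real_asymp
      with True show ?thesis by simp
    qed simp
    show "AE \<theta> in lborel. ((\<lambda>t. indicator {0..2 * pi} \<theta> *\<^sub>R exp ((cos \<theta> - 1) * t)) \<longlongrightarrow> 0) at_top"
      using AE_lborel_singleton[of 0] AE_lborel_singleton[of "2 * pi"] by eventually_elim (rule pointwise)
  qed simp_all
  then show ?thesis
    by (simp add: set_lebesgue_integral_def)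
qed

section \<open>Gaussian lower bound\<close>

text \<open>Half-angle formula: \<open>1 - cos x\<close> is twice the square of
  \<open>sin (x / 2)\<close>, and \<open>\<bar>sin y\<bar> \<le> \<bar>y\<bar>\<close>.\<close>

lemma one_minus_cos_le: "1 - cos x \<le> x\<^sup>2 / 2" for x :: real
proof -
  have "(sin (x / 2))\<^sup>2 \<le> (x / 2)\<^sup>2"
    using abs_sin_x_le_abs_x[of "x / 2"] by (simp only: abs_le_square_iff)
  then show ?thesis
    using cos_double_sin[of "x / 2"] by (simp add: power_divide)
qed

text \<open>The reflection \<open>\<theta> \<mapsto> 2 * pi - \<theta>\<close> preserves the cosine
  and swaps the two halves. The parabolic bound on the cosine is sharp only near 0; folding lets it
  capture the mass near \<open>2 * pi\<close> too, which yields the full constant in the lower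
  bound.\<close>

lemma integral_exp_cos_symmetric:
  "(LBINT \<theta>:{0..2 * pi}. exp ((cos \<theta> - 1) * t)) = 2 * (LBINT \<theta>:{0..pi}. exp ((cos \<theta> - 1) * t))"
proof -
  let ?f = "\<lambda>\<theta>. exp ((cos \<theta> - 1) * t)"
  \<comment> \<open>The substitution reverses orientation; its factor -1 is absorbed by exchanging
    the endpoints on the right.\<close>
  have "(LBINT \<theta>=ereal 0..ereal pi. (- 1) *\<^sub>R ?f (2 * pi - \<theta>)) =
      (LBINT y=ereal (2 * pi - 0)..ereal (2 * pi - pi). ?f y)"
    by (rule interval_integral_substitution_finite)
      (auto intro!: derivative_eq_intros continuous_intros)
  then have "(LBINT \<theta>=ereal pi..ereal (2 * pi). ?f \<theta>) = (LBINT \<theta>=ereal 0..ereal pi. ?f \<theta>)"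
    by (simp add: cos_diff interval_lebesgue_integral_uminus interval_integral_endpoints_reverse[of "ereal (2 * pi)"])
  moreover have "(LBINT \<theta>=ereal 0..ereal pi. ?f \<theta>) + (LBINT \<theta>=ereal pi..ereal (2 * pi). ?f \<theta>) =
      (LBINT \<theta>=ereal 0..ereal (2 * pi). ?f \<theta>)"
    by (rule interval_integral_sum)
      (auto simp: min_def max_def intro!: interval_integrable_isCont continuous_intros)
  ultimately show ?thesis
    by (simp add: interval_integral_Icc[symmetric])
qed

text \<open>Substitution \<open>y = c * \<theta>\<close> with \<open>c = sqrt (t / 2)\<close>, which
  sends the endpoint \<open>pi\<close> to the argument of \<open>Erf\<close>.\<close>

lemma integral_gaussian_eq_Erf:
  assumes "t > 0"
  shows "(LBINT \<theta>:{0..pi}. exp (- (t * \<theta>\<^sup>2 / 2))) = sqrt (pi / (2 * t)) * Erf (pi * sqrt (t / 2))"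
proof -
  define c where "c = sqrt (t / 2)"
  have c: "c > 0" "c\<^sup>2 = t / 2"
    using assms by (simp_all add: c_def)
  have "(LBINT \<theta>=ereal 0..ereal pi. c *\<^sub>R exp (- ((c * \<theta>)\<^sup>2))) =
      (LBINT y=ereal (c * 0)..ereal (c * pi). exp (- (y\<^sup>2)))"
    by (rule interval_integral_substitution_finite)
      (auto intro!: derivative_eq_intros continuous_intros)
  then have "c * (LBINT \<theta>:{0..pi}. exp (- (t * \<theta>\<^sup>2 / 2))) = sqrt pi / 2 * Erf (pi * c)"
    by (simp add: Erf_def interval_integral_Icc[symmetric] power_mult_distrib c mult.commute[of pi])
  then have "(LBINT \<theta>:{0..pi}. exp (- (t * \<theta>\<^sup>2 / 2))) = sqrt pi / 2 * Erf (pi * c) / c"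
    using c(1) by (simp add: field_simps)
  moreover have "sqrt (2 * t) = 2 * c"
    using c by (intro real_sqrt_unique) (simp_all add: power_mult_distrib)
  then have "sqrt (pi / (2 * t)) = sqrt pi / 2 / c"
    by (simp add: real_sqrt_divide)
  ultimately show ?thesis
    unfolding c_def[symmetric] by simp
qed

text \<open>The folded integrand is bounded below by the Gaussian on \<open>{0..pi}\<close>. The
  prefactors combine as \<open>1 / pi * sqrt (pi / (2 * t)) = 1 / sqrt (2 * pi * t)\<close>.\<close>

lemma integral_exp_cos_ge_Erf:
  assumes "t > 0"
  shows "1 / (2 * pi) * (LBINT \<theta>:{0..2 * pi}. exp ((cos \<theta> - 1) * t)) \<ge>
    1 / sqrt (2 * pi * t) * Erf (pi * sqrt (t / 2))"
proof -
  have "exp (- (t * \<theta>\<^sup>2 / 2)) \<le> exp ((cos \<theta> - 1) * t)" for \<theta> :: real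
    using mult_left_mono[OF one_minus_cos_le[of \<theta>], of t] assms by (simp add: algebra_simps)
  then have "(LBINT \<theta>:{0..pi}. exp (- (t * \<theta>\<^sup>2 / 2))) \<le> (LBINT \<theta>:{0..pi}. exp ((cos \<theta> - 1) * t))"
    by (intro set_integral_mono borel_integrable_atLeastAtMost' continuous_intros) auto
  then have "1 / pi * (sqrt (pi / (2 * t)) * Erf (pi * sqrt (t / 2))) \<le>
      1 / (2 * pi) * (LBINT \<theta>:{0..2 * pi}. exp ((cos \<theta> - 1) * t))"
    unfolding integral_gaussian_eq_Erf[OF assms] integral_exp_cos_symmetric
    by (simp add: divide_right_mono)
  moreover have "1 / pi * sqrt (pi / (2 * t)) = 1 / sqrt (2 * pi * t)"
    using assms real_sqrt_mult_self[of pi]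
    by (simp add: real_sqrt_divide real_sqrt_mult field_simps)
  ultimately show ?thesis
    by (simp only: mult.assoc[symmetric])
qed

section \<open>Comparison with exponential decay\<close>

text \<open>On \<open>{0..1}\<close> the integrand is at least \<open>exp (- 1)\<close>, and it is
  nonnegative beyond. A positive constant bound suffices to extract the rate
  \<open>1 / sqrt t\<close>.\<close>

lemma Erf_ge:
  assumes "x \<ge> 1"
  shows "Erf x \<ge> 2 / sqrt pi * exp (- 1)"
proof -
  have "(LBINT y::real. indicator {0..1} y * exp (- 1)) \<le> (LBINT y. indicator {0..x} y *\<^sub>R exp (- (y\<^sup>2)))"
  proof (rule integral_mono)
    have "set_integrable lborel {0..x} (\<lambda>y. exp (- (y\<^sup>2)))"
      by (intro borel_integrable_atLeastAtMost' continuous_intros)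
    then show "integrable lborel (\<lambda>y. indicator {0..x} y *\<^sub>R exp (- (y\<^sup>2)))"
      by (simp add: set_integrable_def)
    show "indicator {0..1} y * exp (- 1) \<le> indicator {0..x} y *\<^sub>R exp (- (y\<^sup>2))" for y :: real
      using assms by (auto simp: indicator_def power_le_one)
  qed simp
  then have "exp (- 1) \<le> (LBINT y=ereal 0..ereal x. exp (- (y\<^sup>2)))"
    using assms by (simp add: interval_integral_Icc set_lebesgue_integral_def)
  then show ?thesis
    unfolding Erf_def by (intro mult_left_mono) auto
qed

text \<open>Makes "much slower" precise: every exponential rate is negligible against
  \<open>1 / sqrt t\<close>, which in turn is bounded by a multiple of \<open>A\<close>.\<close>

lemma exp_smallo_of_Erf_bound:
  fixes A :: "real \<Rightarrow> real"
  assumes A: "\<And>t. t > 0 \<Longrightarrow> A t \<ge> 1 / sqrt (2 * pi * t) * Erf (pi * sqrt (t / 2))"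
    and "c > 0"
  shows "(\<lambda>t. exp (- (c * t))) \<in> o[at_top](A)"
proof (rule landau_o.small_big_trans)
  show "(\<lambda>t. exp (- (c * t))) \<in> o[at_top](\<lambda>t. 1 / sqrt t)"
    using assms(2) by real_asymp
  \<comment> \<open>\<open>k\<close> is the constant in \<open>k / sqrt t \<le> A t\<close>,
    obtained by replacing \<open>Erf\<close> with its lower bound from
    \<open>Erf_ge\<close>.\<close>
  define k where "k = 1 / sqrt (2 * pi) * (2 / sqrt pi * exp (- 1))"
  have k: "k > 0"
    by (simp add: k_def)
  have "norm (1 / sqrt t) \<le> (1 / k) * norm (A t)" if "t \<ge> 1" for t
  proof -
    \<comment> \<open>For \<open>t \<ge> 1\<close> the argument of \<open>Erf\<close> reaches the
      threshold 1 of \<open>Erf_ge\<close>: by \<open>pi \<ge> 2\<close> its square is at least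
      2.\<close>
    have "1 \<le> pi * sqrt (t / 2)"
    proof -
      have "2\<^sup>2 * (1 / 2) \<le> pi\<^sup>2 * (t / 2)"
        using that pi_ge_two by (intro mult_mono power_mono) auto
      then have "1\<^sup>2 \<le> (pi * sqrt (t / 2))\<^sup>2"
        using that by (simp add: power_mult_distrib)
      then show ?thesis
        by (rule power2_le_imp_le) (use that in simp)
    qed
    from Erf_ge[OF this] have "1 / sqrt (2 * pi * t) * (2 / sqrt pi * exp (- 1)) \<le> A t"
      using A[of t] that
      by (meson mult_left_mono order_trans zero_le_divide_1_iff real_sqrt_ge_zero mult_nonneg_nonneg
          pi_ge_zero zero_le_numeral zero_less_one less_le_trans order_less_imp_le)
    then have "k / sqrt t \<le> A t"
      by (simp add: k_def real_sqrt_mult mult_ac)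
    moreover from this have "A t \<ge> 0"
      using k that by (smt (verit) divide_nonneg_nonneg real_sqrt_ge_zero)
    ultimately show ?thesis
      using k that by (simp add: field_simps)
  qed
  then show "(\<lambda>t. 1 / sqrt t) \<in> O[at_top](A)"
    by (intro bigoI[of _ "1 / k"] eventually_mono[OF eventually_ge_at_top[of 1]])
qed

theorem mainTheorem1:
  fixes T :: "(real \<Rightarrow> real) set"
    and g :: "real \<Rightarrow> real \<Rightarrow> real"
    and f :: "real \<Rightarrow> real \<Rightarrow> real \<Rightarrow> real"
  assumes id_admissible: "(\<lambda>v. v) \<in> T"
    and g_solution: "deterministic_solution T g"
    and g_moment: "\<And>t. t \<ge> 0 \<Longrightarrow> finite_first_moment (g t)"
    and f_solution: "\<And>\<theta>. \<theta> \<in> {0..2 * pi} \<Longrightarrow> stochastic_solution T \<theta> (f \<theta>)"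
    and f_moment: "\<And>\<theta> t. \<theta> \<in> {0..2 * pi} \<Longrightarrow> t \<ge> 0 \<Longrightarrow> finite_first_moment (f \<theta> t)"
    and g_init: "mean (g 0) = 1"
    and f_init: "\<And>\<theta>. \<theta> \<in> {0..2 * pi} \<Longrightarrow> mean (f \<theta> 0) = 1"
  shows "(\<forall>t\<ge>0. mean (g t) = exp (- t)) \<and>
    (\<forall>t\<ge>0. \<forall>\<theta>\<in>{0..2 * pi}. mean (f \<theta> t) = exp ((cos \<theta> - 1) * t)) \<and>
    (\<forall>t\<ge>0. averaged_mean f t = 1 / (2 * pi) * (LBINT \<theta>:{0..2 * pi}. exp ((cos \<theta> - 1) * t))) \<and>
    ((\<lambda>t. mean (g t)) \<longlongrightarrow> 0) at_top \<and>
    (averaged_mean f \<longlongrightarrow> 0) at_top \<and>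
    (\<forall>t>0. averaged_mean f t \<ge> 1 / sqrt (2 * pi * t) * Erf (pi * sqrt (t / 2))) \<and>
    (\<lambda>t. mean (g t)) \<in> o[at_top](averaged_mean f) \<and>
    (\<forall>c>0. (\<lambda>t. exp (- (c * t))) \<in> o[at_top](averaged_mean f))"
proof -
  have mg: "mean (g t) = exp (- t)" if "t \<ge> 0" for t
    using mean_deterministic_solution[OF id_admissible g_solution that] g_init by simp
  have mf: "mean (f \<theta> t) = exp ((cos \<theta> - 1) * t)" if "t \<ge> 0" "\<theta> \<in> {0..2 * pi}" for t \<theta>
    using mean_stochastic_solution[OF id_admissible f_solution[OF that(2)] that(1)] f_init[OF that(2)] by simp
  have av: "averaged_mean f t = 1 / (2 * pi) * (LBINT \<theta>:{0..2 * pi}. exp ((cos \<theta> - 1) * t))"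
    if "t \<ge> 0" for t
  proof -
    have "averaged_mean f t = (LBINT \<theta>:{0..2 * pi}. 1 / (2 * pi) * exp ((cos \<theta> - 1) * t))"
      unfolding averaged_mean_def
      by (rule set_lebesgue_integral_cong) (auto simp: mf that rho_def)
    then show ?thesis by simp
  qed
  have mg0: "((\<lambda>t. mean (g t)) \<longlongrightarrow> 0) at_top"
  proof (rule Lim_transform_eventually)
    show "((\<lambda>t::real. exp (- t)) \<longlongrightarrow> 0) at_top"
      by real_asymp
    show "\<forall>\<^sub>F t in at_top. exp (- t) = mean (g t)"
      using eventually_ge_at_top[of 0] by eventually_elim (simp add: mg)
  qed
  have av0: "(averaged_mean f \<longlongrightarrow> 0) at_top"
  proof (rule Lim_transform_eventually)
    show "((\<lambda>t. 1 / (2 * pi) * (LBINT \<theta>:{0..2 * pi}. exp ((cos \<theta> - 1) * t))) \<longlongrightarrow> 0) at_top"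
      using tendsto_mult_left[OF tendsto_integral_exp_cos, of "1 / (2 * pi)"] by simp
    show "\<forall>\<^sub>F t in at_top. 1 / (2 * pi) * (LBINT \<theta>:{0..2 * pi}. exp ((cos \<theta> - 1) * t)) = averaged_mean f t"
      using eventually_ge_at_top[of 0] by eventually_elim (simp add: av)
  qed
  have lower: "averaged_mean f t \<ge> 1 / sqrt (2 * pi * t) * Erf (pi * sqrt (t / 2))" if "t > 0" for t
    using integral_exp_cos_ge_Erf[OF that] av[of t] that by simp
  note exp_o = exp_smallo_of_Erf_bound[of "averaged_mean f", OF lower]
  \<comment> \<open>The closed form of the mean is known only for \<open>t \<ge> 0\<close>, but
    Landau classes depend only on eventual values. The factor \<open>1 * t\<close> fits the general
    rate \<open>c * t\<close> at \<open>c = 1\<close>.\<close>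
  have "(\<lambda>t. mean (g t)) \<in> o[at_top](averaged_mean f) \<longleftrightarrow>
      (\<lambda>t. exp (- (1 * t))) \<in> o[at_top](averaged_mean f)"
    by (rule landau_o.small.in_cong)
      (use eventually_ge_at_top[of 0] in \<open>eventually_elim, simp add: mg\<close>)
  with exp_o[of 1] have "(\<lambda>t. mean (g t)) \<in> o[at_top](averaged_mean f)"
    by simp
  with mg mf av mg0 av0 lower exp_o show ?thesis
    by blast
qed

end
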